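(* Let $\epsilon\in(0,1)$, $\sigma\ge 1$ and $0<\rho\le 1$. (i) Consider an SCSK instance with budget $b$, where $\min_j f(\{j\})\le b\le f(V)$, and suppose we are given a $[\sigma,\rho]$ bicriterion approximation algorithm $\mathcal A$ for SCSC. Run the following procedure. Initialize $c\leftarrow g(V)$ and $\hat X_c\leftarrow V$. While $f(\hat X_c)>\sigma b$, set $c\leftarrow(1-\epsilon)c$ and let $\hat X_c$ be the output of $\mathcal A$ on the SCSC instance with cover parameter $c$. Return $\hat X_c$. This procedure returns a set $\hat X_c$ that is a $[(1-\epsilon)\rho,\sigma]$ bicriterion approximation for the SCSK instance, that is, $g(\hat X_c)\ge(1-\epsilon)\rho\, g(X^* )$ and $f(\hat X_c)\le\sigma b$, where $X^*$ is an optimal solution of SCSK. It does so using at most $\log_{1/(1-\epsilon)}[g(V)/\min_j g(\{j\})]$ calls to $\mathcal A$. (ii) Consider an SCSC instance with cover parameter $c$, where $\min_j g(\{j\})\le c\le g(V)$, and suppose we are given a $[\rho,\sigma]$ bicriterion approximation algorithm $\mathcal B$ for SCSK. Run the following procedure. Initialize $b\leftarrow\min_j f(\{j\})$ and $\hat X_b\leftarrow\emptyset$. While $g(\hat X_b)<\rho c$, set $b\leftarrow(1+\epsilon)b$ and let $\hat X_b$ be the output of $\mathcal B$ on the SCSK instance with budget $b$. Return $\hat X_b$. This procedure returns a set $\hat X_b$ that is a $[(1+\epsilon)\sigma,\rho]$ bicriterion approximation for the SCSC instance, that is, $f(\hat X_b)\le(1+\epsilon)\sigma f(X^* )$ and $g(\hat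 X_b)\ge\rho c$, where $X^*$ is an optimal solution of SCSC. It does so using at most $\log_{1+\epsilon}[f(V)/\min_j f(\{j\})]$ calls to $\mathcal B$.
   Context: Let $V=\{1,\dots,n\}$. A set function $h:2^V\to\mathbb R$ is submodular if $h(S)+h(T)\ge h(S\cup T)+h(S\cap T)$ for all $S,T\subseteq V$. It is a polymatroid function if, in addition, it is monotone non-decreasing and $h(\emptyset)=0$. Let $f,g:2^V\to\mathbb R$ be polymatroid functions with $f(\{j\})>0$ and $g(\{j\})>0$ for all $j\in V$. SCSC (submodular cost submodular cover) with cover parameter $c$ is the problem $\min\{f(X): g(X)\ge c\}$. SCSK (submodular cost submodular knapsack) with budget $b$ is the problem $\max\{g(X): f(X)\le b\}$. An algorithm is a $[\sigma,\rho]$ bicriterion approximation for SCSC if it returns a set $X$ with $f(X)\le\sigma f(X^* )$ and $g(X)\ge\rho c$, where $X^*$ is an optimal solution of SCSC. An algorithm is a $[\rho,\sigma]$ bicriterion approximation for SCSK if it returns a set $X$ with $g(X)\ge\rho\, g(X^* )$ and $f(X)\le\sigma b$, where $X^*$ is an optimal solution of SCSK. Here $\sigma\ge1$ and $\rho\le 1$. The paper assumes throughout that $f(V)\ge b\ge\min_j f(\{j\})$ and $g(V)\ge c\ge\min_j g(\{j\})$, to avoid trivial instances.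
   Formalization: The call bounds are proved as max(1, ⌈log[...]⌉), since the printed bounds fail (n=1, f=g=card, c=1 needs one call but log 1 = 0); A is assumed correct for all 0<c≤g(V) and B for all b≥min_j f({j}), because the procedures leave the standing parameter ranges. *)

theory Defs
  imports Complex_Main "HOL-Library.While_Combinator"
begin

definition submodular_on :: "'a set \<Rightarrow> ('a set \<Rightarrow> real) \<Rightarrow> bool" where
  "submodular_on V h \<longleftrightarrow>
     (\<forall>S T. S \<subseteq> V \<longrightarrow> T \<subseteq> V \<longrightarrow> h S + h T \<ge> h (S \<union> T) + h (S \<inter> T))"

definition polymatroid_on :: "'a set \<Rightarrow> ('a set \<Rightarrow> real) \<Rightarrow> bool" where
  "polymatroid_on V h \<longleftrightarrow> submodular_on V h \<and> mono_on (Pow V) h \<and> h {} = 0"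

definition min_singleton :: "'a set \<Rightarrow> ('a set \<Rightarrow> real) \<Rightarrow> real" where
  "min_singleton V h = Min ((\<lambda>j. h {j}) ` V)"

definition scsc_optimal ::
    "'a set \<Rightarrow> ('a set \<Rightarrow> real) \<Rightarrow> ('a set \<Rightarrow> real) \<Rightarrow> real \<Rightarrow> 'a set \<Rightarrow> bool" where
  "scsc_optimal V f g c X \<longleftrightarrow> is_arg_min f (\<lambda>Y. Y \<subseteq> V \<and> g Y \<ge> c) X"

definition scsk_optimal ::
    "'a set \<Rightarrow> ('a set \<Rightarrow> real) \<Rightarrow> ('a set \<Rightarrow> real) \<Rightarrow> real \<Rightarrow> 'a set \<Rightarrow> bool" where
  "scsk_optimal V f g b X \<longleftrightarrow> is_arg_max g (\<lambda>Y. Y \<subseteq> V \<and> f Y \<le> b) X"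

text \<open>Quantifying over all optimal solutions is harmless: they share one objective value,
  and for finite \<open>V\<close> one exists whenever the instance is feasible (the two existence lemmas below).\<close>

definition scsc_approx ::
    "'a set \<Rightarrow> ('a set \<Rightarrow> real) \<Rightarrow> ('a set \<Rightarrow> real) \<Rightarrow> real \<Rightarrow> real \<Rightarrow> real \<Rightarrow> 'a set \<Rightarrow> bool" where
  "scsc_approx V f g c \<sigma> \<rho> X \<longleftrightarrow>
     X \<subseteq> V \<and> (\<forall>X'. scsc_optimal V f g c X' \<longrightarrow> f X \<le> \<sigma> * f X') \<and> g X \<ge> \<rho> * c"

definition scsk_approx ::
    "'a set \<Rightarrow> ('a set \<Rightarrow> real) \<Rightarrow> ('a set \<Rightarrow> real) \<Rightarrow> real \<Rightarrow> real \<Rightarrow> real \<Rightarrow> 'a set \<Rightarrow> bool" where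
  "scsk_approx V f g b \<rho> \<sigma> X \<longleftrightarrow>
     X \<subseteq> V \<and> (\<forall>X'. scsk_optimal V f g b X' \<longrightarrow> g X \<ge> \<rho> * g X') \<and> f X \<le> \<sigma> * b"

lemma scsc_optimal_exists:
  assumes "finite V" "c \<le> g V"
  shows "\<exists>X. scsc_optimal V f g c X"
proof -
  have fin: "finite {Y. Y \<subseteq> V \<and> g Y \<ge> c}" using assms(1) by simp
  have ne: "{Y. Y \<subseteq> V \<and> g Y \<ge> c} \<noteq> {}" using assms(2) by blast
  show ?thesis
    unfolding scsc_optimal_def
    using ex_is_arg_min_if_finite[OF fin ne, of f] by simp
qed

lemma scsk_optimal_exists:
  assumes "finite V" "f {} \<le> b"
  shows "\<exists>X. scsk_optimal V f g b X"
proof -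
  have fin: "finite {Y. Y \<subseteq> V \<and> f Y \<le> b}" using assms(1) by simp
  have ne: "{Y. Y \<subseteq> V \<and> f Y \<le> b} \<noteq> {}" using assms(2) by blast
  show ?thesis
    unfolding scsk_optimal_def is_arg_max_def
    using ex_is_arg_min_if_finite[OF fin ne, of "\<lambda>X. - g X"] by (simp add: is_arg_min_def)
qed

text \<open>For fixed \<open>V\<close>, \<open>f\<close>, \<open>g\<close>, an algorithm is represented by the map from the instance
  parameter to the returned set. The parameter ranges are those the two reductions reach: the first
  can lower \<open>c\<close> below \<open>min_singleton V g\<close> and the second can raise \<open>b\<close> above \<open>f V\<close>, so neither
  bound may be imposed here.\<close>

definition scsc_approx_algorithm ::
    "'a set \<Rightarrow> ('a set \<Rightarrow> real) \<Rightarrow> ('a set \<Rightarrow> real) \<Rightarrow> real \<Rightarrow> real \<Rightarrow> (real \<Rightarrow> 'a set) \<Rightarrow> bool" where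
  "scsc_approx_algorithm V f g \<sigma> \<rho> A \<longleftrightarrow>
     (\<forall>c. 0 < c \<and> c \<le> g V \<longrightarrow> scsc_approx V f g c \<sigma> \<rho> (A c))"

definition scsk_approx_algorithm ::
    "'a set \<Rightarrow> ('a set \<Rightarrow> real) \<Rightarrow> ('a set \<Rightarrow> real) \<Rightarrow> real \<Rightarrow> real \<Rightarrow> (real \<Rightarrow> 'a set) \<Rightarrow> bool" where
  "scsk_approx_algorithm V f g \<rho> \<sigma> B \<longleftrightarrow>
     (\<forall>b. min_singleton V f \<le> b \<longrightarrow> scsk_approx V f g b \<rho> \<sigma> (B b))"

text \<open>The loop state is (current parameter, current set, number of oracle calls made so far);
  the result is \<open>None\<close> iff the loop does not terminate.\<close>

definition scsk_by_scsc ::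
    "'a set \<Rightarrow> ('a set \<Rightarrow> real) \<Rightarrow> ('a set \<Rightarrow> real) \<Rightarrow> real \<Rightarrow> real \<Rightarrow> real \<Rightarrow> (real \<Rightarrow> 'a set)
      \<Rightarrow> (real \<times> 'a set \<times> nat) option" where
  "scsk_by_scsc V f g \<epsilon> \<sigma> b A =
     while_option (\<lambda>(c, X, k). f X > \<sigma> * b)
       (\<lambda>(c, X, k). ((1 - \<epsilon>) * c, A ((1 - \<epsilon>) * c), k + 1))
       (g V, V, 0)"

definition scsc_by_scsk ::
    "'a set \<Rightarrow> ('a set \<Rightarrow> real) \<Rightarrow> ('a set \<Rightarrow> real) \<Rightarrow> real \<Rightarrow> real \<Rightarrow> real \<Rightarrow> (real \<Rightarrow> 'a set)
      \<Rightarrow> (real \<times> 'a set \<times> nat) option" where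
  "scsc_by_scsk V f g \<epsilon> \<rho> c B =
     while_option (\<lambda>(b, X, k). g X < \<rho> * c)
       (\<lambda>(b, X, k). ((1 + \<epsilon>) * b, B ((1 + \<epsilon>) * b), k + 1))
       (min_singleton V f, {}, 0)"

end

theory Submission
  imports Defs
begin

text \<open>
  In each reduction a failed stopping test certifies a bound on the optimum. If the output of the
  cover algorithm at level \<open>c\<close> costs more than \<open>\<sigma> * b\<close>, then every set covering \<open>c\<close> costs more
  than \<open>b\<close>, so the optimal knapsack value is below \<open>c\<close>; dually, if the output of the knapsack
  algorithm at budget \<open>b\<close> has value below \<open>\<rho> * c\<close>, then every set covering \<open>c\<close> costs more than
  \<open>b\<close>. One geometric step past the last failure therefore loses only a factor \<open>1 - \<epsilon>\<close>
  or \<open>1 + \<epsilon>\<close>. Applied to a cheapest singleton and to \<open>V\<close> respectively, the same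
  certificates bound the parameter at every failed call, and hence the number of calls.
\<close>

section \<open>Loops with an invariant, and counting geometric steps\<close>

lemma while_option_invariant_terminates:
  fixes m :: "'s \<Rightarrow> nat"
  assumes "P s" and "\<And>s. P s \<Longrightarrow> t s \<Longrightarrow> P (u s) \<and> m (u s) < m s"
  obtains r where "while_option t u s = Some r" "P r" "\<not> t r"
proof -
  obtain r where r: "while_option t u s = Some r"
    using measure_while_option_Some[of P t u m s] assms by blast
  moreover have "P r"
    using while_option_rule[of P t u s r] assms r by blast
  ultimately show thesis
    using that while_option_stop[of t u s r] by blast
qed

text \<open>The inequality is strict, so the integer \<open>k\<close> lies strictly below the
  logarithm and hence at least one below its ceiling. In the loops \<open>k\<close> is the number of
  calls already made when the test fails again, and \<open>Suc k\<close> includes the call about to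
  be made.\<close>

lemma Suc_le_ceiling_log:
  fixes a m M :: real
  assumes "1 < a" "0 < m" "a ^ k * m < M"
  shows "int (Suc k) \<le> \<lceil>log a (M / m)\<rceil>"
proof -
  have "a ^ k < M / m"
    using assms by (simp add: pos_less_divide_eq)
  moreover have "0 < a ^ k"
    using assms by simp
  ultimately have "log a (a ^ k) < log a (M / m)"
    using assms(1) log_less_cancel_iff[of a "a ^ k" "M / m"] by linarith
  then have "real k < log a (M / m)"
    using assms by (simp add: log_nat_power)
  then have "int k < \<lceil>log a (M / m)\<rceil>"
    by (simp add: less_ceiling_iff)
  then show ?thesis
    by linarith
qed

section \<open>Polymatroid functions and cheapest singletons\<close>

lemma polymatroid_on_mono:
  "polymatroid_on V h \<Longrightarrow> S \<subseteq> T \<Longrightarrow> T \<subseteq> V \<Longrightarrow> h S \<le> h T"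
  using mono_onD[of "Pow V" h S T] by (auto simp: polymatroid_on_def)

lemma polymatroid_on_nonneg:
  "polymatroid_on V h \<Longrightarrow> S \<subseteq> V \<Longrightarrow> 0 \<le> h S"
  using polymatroid_on_mono[of V h "{}" S] by (simp add: polymatroid_on_def)

lemma min_singleton_le:
  "finite V \<Longrightarrow> j \<in> V \<Longrightarrow> min_singleton V h \<le> h {j}"
  by (simp add: min_singleton_def)

lemma min_singleton_attained:
  assumes "finite V" "V \<noteq> {}"
  obtains j where "j \<in> V" "h {j} = min_singleton V h"
proof -
  have "min_singleton V h \<in> (\<lambda>j. h {j}) ` V"
    using Min_in[of "(\<lambda>j. h {j}) ` V"] assms by (simp add: min_singleton_def)
  then show thesis
    using that by force
qed

lemma min_singleton_pos:
  assumes "finite V" "V \<noteq> {}" "\<And>j. j \<in> V \<Longrightarrow> 0 < h {j}"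
  shows "0 < min_singleton V h"
  using assms by (simp add: min_singleton_def)

lemma min_singleton_le_nonempty:
  assumes "finite V" "polymatroid_on V h" "S \<subseteq> V" "S \<noteq> {}"
  shows "min_singleton V h \<le> h S"
proof -
  obtain j where "j \<in> S" using assms by blast
  then show ?thesis
    using min_singleton_le[of V j h] polymatroid_on_mono[of V h "{j}" S] assms
    by (auto intro: order_trans)
qed

section \<open>Certificates drawn from a failed stopping test\<close>

lemma scsc_approx_expensive:
  assumes "finite V" "c \<le> g V" "0 \<le> \<sigma>"
    and "scsc_approx V f g c \<sigma> \<rho> X" "\<sigma> * b < f X" "Y \<subseteq> V" "f Y \<le> b"
  shows "g Y < c"
proof (rule ccontr)
  assume "\<not> g Y < c"
  \<comment> \<open>The approximation guarantee speaks only of optimal sets, so one must exist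
    before it says anything; \<open>c \<le> g V\<close> makes \<open>V\<close> feasible. An
    affordable \<open>Y\<close> covering \<open>c\<close> would give \<open>Z\<close> cost at most
    \<open>b\<close>, and then \<open>X\<close> cost at most \<open>\<sigma> * b\<close>.\<close>
  obtain Z where Z: "scsc_optimal V f g c Z"
    using scsc_optimal_exists assms(1,2) by blast
  then have "f Z \<le> f Y"
    using \<open>\<not> g Y < c\<close> assms(6) unfolding scsc_optimal_def is_arg_min_def by (meson not_le)
  then have "\<sigma> * f Z \<le> \<sigma> * b"
    using assms by (intro mult_left_mono) auto
  then show False
    using Z assms(4,5) unfolding scsc_approx_def by force
qed

lemma scsk_approx_insufficient:
  assumes "finite V" "f {} \<le> b" "0 < \<rho>"
    and "scsk_approx V f g b \<rho> \<sigma> X" "g X < \<rho> * c" "Y \<subseteq> V" "c \<le> g Y"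
  shows "b < f Y"
proof (rule ccontr)
  assume "\<not> b < f Y"
  \<comment> \<open>Here the empty set is the feasible set that ensures an optimum.\<close>
  obtain Z where Z: "scsk_optimal V f g b Z"
    using scsk_optimal_exists assms(1,2) by blast
  then have "g Y \<le> g Z"
    using \<open>\<not> b < f Y\<close> assms(6) unfolding scsk_optimal_def is_arg_max_def by (meson not_le)
  then have "\<rho> * c \<le> \<rho> * g Z"
    using assms by (intro mult_left_mono) auto
  then show False
    using Z assms(4,5) unfolding scsk_approx_def by force
qed

section \<open>Knapsack by repeated covering\<close>

lemma scsk_by_scsc_correct:
  fixes \<epsilon> \<sigma> \<rho> b :: real
  assumes V: "finite V" "V \<noteq> {}"
    and g: "polymatroid_on V g" "\<And>j. j \<in> V \<Longrightarrow> 0 < g {j}"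
    and eps: "0 < \<epsilon>" "\<epsilon> < 1" and \<sigma>: "1 \<le> \<sigma>" and \<rho>: "0 < \<rho>" "\<rho> \<le> 1"
    and b: "min_singleton V f \<le> b"
    and A: "scsc_approx_algorithm V f g \<sigma> \<rho> A"
  obtains c X k where "scsk_by_scsc V f g \<epsilon> \<sigma> b A = Some (c, X, k)"
    and "scsk_approx V f g b ((1 - \<epsilon>) * \<rho>) \<sigma> X"
    and "int k \<le> max 1 \<lceil>log (1 / (1 - \<epsilon>)) (g V / min_singleton V g)\<rceil>"
proof -
  define N where "N = max 1 \<lceil>log (1 / (1 - \<epsilon>)) (g V / min_singleton V g)\<rceil>"
  \<comment> \<open>The clause on affordable \<open>Y\<close> carries the factor
    \<open>1 - \<epsilon>\<close> because its certificate comes from the preceding, larger level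
    \<open>c / (1 - \<epsilon>)\<close>. The approximation clause exempts \<open>k = 0\<close>,
    since the initial \<open>V\<close> is not an output of \<open>A\<close>; the bound
    \<open>\<rho> * c \<le> g X\<close> is kept separately because it holds there too.\<close>
  define Inv where "Inv = (\<lambda>(c, X, k).
    c = (1 - \<epsilon>) ^ k * g V \<and> X \<subseteq> V \<and> \<rho> * c \<le> g X \<and>
    (k = 0 \<or> scsc_approx V f g c \<sigma> \<rho> X) \<and>
    (\<forall>Y\<subseteq>V. f Y \<le> b \<longrightarrow> (1 - \<epsilon>) * g Y \<le> c) \<and> int k \<le> N)"
  have gpos: "0 < min_singleton V g"
    using min_singleton_pos V g(2) by blast
  have gV: "0 < g V"
    using min_singleton_le_nonempty[OF V(1) g(1) order_refl V(2)] gpos by linarith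
  have init: "Inv (g V, V, 0)"
  proof -
    have "(1 - \<epsilon>) * g Y \<le> g V" if "Y \<subseteq> V" for Y
      using mult_right_mono[of "1 - \<epsilon>" 1 "g Y"] eps polymatroid_on_nonneg[OF g(1) that]
        polymatroid_on_mono[OF g(1) that order_refl] by simp
    then show ?thesis
      using \<rho> gV by (simp add: Inv_def N_def)
  qed
  have step: "Inv ((1 - \<epsilon>) * c, A ((1 - \<epsilon>) * c), Suc k) \<and> int k < N"
    if inv: "Inv (c, X, k)" and run: "\<sigma> * b < f X" for c X k
  proof -
    have c: "c = (1 - \<epsilon>) ^ k * g V" and kX: "k = 0 \<or> scsc_approx V f g c \<sigma> \<rho> X"
      using inv by (auto simp: Inv_def)
    have cle: "0 < c" "c \<le> g V"
      using c gV eps by (auto simp: power_le_one mult_left_le_one_le)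
    have "(1 - \<epsilon>) * c \<le> c"
      using cle eps by (simp add: mult_left_le_one_le)
    then have "0 < (1 - \<epsilon>) * c" "(1 - \<epsilon>) * c \<le> g V"
      using cle eps by (simp, linarith)
    then have app: "scsc_approx V f g ((1 - \<epsilon>) * c) \<sigma> \<rho> (A ((1 - \<epsilon>) * c))"
      using A unfolding scsc_approx_algorithm_def by blast
    \<comment> \<open>Before the first call there is no output to serve as a certificate, but then
      \<open>c = g V\<close> and monotonicity suffices.\<close>
    have bound: "g Y \<le> c" if "Y \<subseteq> V" "f Y \<le> b" for Y
    proof (cases "k = 0")
      case True
      then show ?thesis using c polymatroid_on_mono[OF g(1) that(1)] by simp
    next
      case False
      then show ?thesis
        using scsc_approx_expensive[of V c g \<sigma> f \<rho> X b Y] V(1) cle(2) run that kX \<sigma> by linarith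
    qed
    \<comment> \<open>The certificate is applied to a singleton minimising \<open>f\<close>, which
      the budget admits because \<open>min_singleton V f \<le> b\<close>. Its \<open>g\<close>-value
      is at least \<open>min_singleton V g\<close>, so \<open>c\<close> is still above that minimum
      at every failed call.\<close>
    have "int (Suc k) \<le> N"
    proof (cases "k = 0")
      case False
      obtain j where j: "j \<in> V" "f {j} = min_singleton V f"
        using min_singleton_attained V by blast
      have "g {j} < c"
        using scsc_approx_expensive[of V c g \<sigma> f \<rho> X b "{j}"] V(1) cle(2) run kX False \<sigma> j b
        by simp
      then have "min_singleton V g < (1 - \<epsilon>) ^ k * g V"
        using min_singleton_le[OF V(1) j(1), of g] c by linarith
      then have "(1 / (1 - \<epsilon>)) ^ k * min_singleton V g < g V"
        using eps by (simp add: power_one_over field_simps)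
      then have "int (Suc k) \<le> \<lceil>log (1 / (1 - \<epsilon>)) (g V / min_singleton V g)\<rceil>"
        using eps gpos by (intro Suc_le_ceiling_log) auto
      then show ?thesis by (simp add: N_def)
    qed (simp add: N_def)
    moreover have "\<forall>Y\<subseteq>V. f Y \<le> b \<longrightarrow> (1 - \<epsilon>) * g Y \<le> (1 - \<epsilon>) * c"
      using bound eps by (auto intro: mult_left_mono)
    ultimately show ?thesis
      using app c unfolding Inv_def by (auto simp: scsc_approx_def)
  qed
  obtain r where r: "scsk_by_scsc V f g \<epsilon> \<sigma> b A = Some r" "Inv r"
      "\<not> (case r of (c, X, k) \<Rightarrow> \<sigma> * b < f X)"
    unfolding scsk_by_scsc_def
  \<comment> \<open>The measure is the number of calls still allowed by \<open>N\<close>, so the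
    call bound itself yields termination.\<close>
  proof (rule while_option_invariant_terminates
      [of Inv _ "\<lambda>(c, X, k). \<sigma> * b < f X" "\<lambda>(c, X, k). ((1 - \<epsilon>) * c, A ((1 - \<epsilon>) * c), k + 1)"
        "\<lambda>(c, X, k). nat (N - int k)", OF init], goal_cases)
    case (1 s)
    obtain c X k where "s = (c, X, k)" by (cases s)
    then show ?case using 1 step[of c X k] by simp
  next
    case (2 r)
    then show ?case by blast
  qed
  obtain c X k where cXk: "r = (c, X, k)" by (cases r)
  have inv: "X \<subseteq> V" "\<rho> * c \<le> g X" "\<And>Y. Y \<subseteq> V \<Longrightarrow> f Y \<le> b \<Longrightarrow> (1 - \<epsilon>) * g Y \<le> c" "int k \<le> N"
    using r(2) by (auto simp: Inv_def cXk)
  have "(1 - \<epsilon>) * \<rho> * g Y \<le> g X" if "scsk_optimal V f g b Y" for Y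
  proof -
    have "(1 - \<epsilon>) * g Y \<le> c"
      using that inv(3) by (simp add: scsk_optimal_def is_arg_max_def)
    then have "\<rho> * ((1 - \<epsilon>) * g Y) \<le> \<rho> * c"
      using \<rho> by (intro mult_left_mono) auto
    then show ?thesis
      using inv(2) by (simp add: algebra_simps)
  qed
  then have "scsk_approx V f g b ((1 - \<epsilon>) * \<rho>) \<sigma> X"
    using inv(1) r(3) cXk by (simp add: scsk_approx_def)
  then show thesis
    using that r(1) cXk inv(4) by (simp add: N_def)
qed

section \<open>Cover by repeated knapsack\<close>

lemma scsc_by_scsk_correct:
  fixes \<epsilon> \<sigma> \<rho> c :: real
  assumes V: "finite V" "V \<noteq> {}"
    and f: "polymatroid_on V f" "\<And>j. j \<in> V \<Longrightarrow> 0 < f {j}"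
    and g0: "g {} = 0"
    and eps: "0 < \<epsilon>" and \<sigma>: "0 \<le> \<sigma>" and \<rho>: "0 < \<rho>"
    and c: "0 < c" "c \<le> g V"
    and B: "scsk_approx_algorithm V f g \<rho> \<sigma> B"
  obtains b X k where "scsc_by_scsk V f g \<epsilon> \<rho> c B = Some (b, X, k)"
    and "scsc_approx V f g c ((1 + \<epsilon>) * \<sigma>) \<rho> X"
    and "int k \<le> max 1 \<lceil>log (1 + \<epsilon>) (f V / min_singleton V f)\<rceil>"
proof -
  define N where "N = max 1 \<lceil>log (1 + \<epsilon>) (f V / min_singleton V f)\<rceil>"
  \<comment> \<open>The bound on covers \<open>Y\<close> again stems from the preceding level, here
    \<open>b / (1 + \<epsilon>)\<close>. At \<open>k = 0\<close> the set is empty and not an output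
    of \<open>B\<close>, but its zero cost gives \<open>f X \<le> \<sigma> * b\<close>.\<close>
  define Inv where "Inv = (\<lambda>(b, X, k).
    b = (1 + \<epsilon>) ^ k * min_singleton V f \<and> X \<subseteq> V \<and> f X \<le> \<sigma> * b \<and>
    (k = 0 \<or> scsk_approx V f g b \<rho> \<sigma> X) \<and>
    (\<forall>Y\<subseteq>V. c \<le> g Y \<longrightarrow> b \<le> (1 + \<epsilon>) * f Y) \<and> int k \<le> N)"
  have fpos: "0 < min_singleton V f"
    using min_singleton_pos V f(2) by blast
  have f0: "f {} = 0"
    using f(1) by (simp add: polymatroid_on_def)
  \<comment> \<open>A set covering \<open>c > 0\<close> is nonempty because \<open>g {} = 0\<close>,
    so it costs at least as much as some singleton. This stands in for a certificate before the
    first call.\<close>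
  have cover: "min_singleton V f \<le> f Y" if "Y \<subseteq> V" "c \<le> g Y" for Y
    using min_singleton_le_nonempty[OF V(1) f(1) that(1)] that(2) g0 c(1) by fastforce
  have init: "Inv (min_singleton V f, {}, 0)"
  proof -
    have "min_singleton V f \<le> (1 + \<epsilon>) * f Y" if "Y \<subseteq> V" "c \<le> g Y" for Y
      using mult_right_mono[of 1 "1 + \<epsilon>" "f Y"] eps cover[OF that] fpos by linarith
    then show ?thesis
      using \<sigma> fpos f0 by (simp add: Inv_def N_def)
  qed
  have step: "Inv ((1 + \<epsilon>) * b, B ((1 + \<epsilon>) * b), Suc k) \<and> int k < N"
    if inv: "Inv (b, X, k)" and run: "g X < \<rho> * c" for b X k
  proof -
    have b: "b = (1 + \<epsilon>) ^ k * min_singleton V f" and kX: "k = 0 \<or> scsk_approx V f g b \<rho> \<sigma> X"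
      using inv by (auto simp: Inv_def)
    have ble: "min_singleton V f \<le> b"
      using b fpos eps by simp
    then have b0: "f {} \<le> b"
      using f0 fpos by simp
    have "b \<le> (1 + \<epsilon>) * b"
      using ble fpos eps by (simp add: distrib_right)
    then have "min_singleton V f \<le> (1 + \<epsilon>) * b"
      using ble by linarith
    then have app: "scsk_approx V f g ((1 + \<epsilon>) * b) \<rho> \<sigma> (B ((1 + \<epsilon>) * b))"
      using B unfolding scsk_approx_algorithm_def by blast
    have bound: "b \<le> f Y" if "Y \<subseteq> V" "c \<le> g Y" for Y
    proof (cases "k = 0")
      case True
      then show ?thesis using b cover[OF that] by simp
    next
      case False
      then show ?thesis
        using scsk_approx_insufficient[of V f b \<rho> g \<sigma> X c Y] V(1) b0 \<rho> run that kX by linarith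
    qed
    \<comment> \<open>\<open>V\<close> itself covers \<open>c\<close>, so a failed call certifies
      \<open>b < f V\<close>, which limits the growth of \<open>b\<close>.\<close>
    have "int (Suc k) \<le> N"
    proof (cases "k = 0")
      case False
      then have "(1 + \<epsilon>) ^ k * min_singleton V f < f V"
        using scsk_approx_insufficient[of V f b \<rho> g \<sigma> X c V] V(1) b0 \<rho> run c(2) kX b by simp
      then have "int (Suc k) \<le> \<lceil>log (1 + \<epsilon>) (f V / min_singleton V f)\<rceil>"
        using eps fpos by (intro Suc_le_ceiling_log) auto
      then show ?thesis by (simp add: N_def)
    qed (simp add: N_def)
    moreover have "\<forall>Y\<subseteq>V. c \<le> g Y \<longrightarrow> (1 + \<epsilon>) * b \<le> (1 + \<epsilon>) * f Y"
      using bound eps by (auto intro: mult_left_mono)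
    ultimately show ?thesis
      using app b unfolding Inv_def by (auto simp: scsk_approx_def)
  qed
  obtain r where r: "scsc_by_scsk V f g \<epsilon> \<rho> c B = Some r" "Inv r"
      "\<not> (case r of (b, X, k) \<Rightarrow> g X < \<rho> * c)"
    unfolding scsc_by_scsk_def
  proof (rule while_option_invariant_terminates
      [of Inv _ "\<lambda>(b, X, k). g X < \<rho> * c" "\<lambda>(b, X, k). ((1 + \<epsilon>) * b, B ((1 + \<epsilon>) * b), k + 1)"
        "\<lambda>(b, X, k). nat (N - int k)", OF init], goal_cases)
    case (1 s)
    obtain b X k where "s = (b, X, k)" by (cases s)
    then show ?case using 1 step[of b X k] by simp
  next
    case (2 r)
    then show ?case by blast
  qed
  obtain b X k where bXk: "r = (b, X, k)" by (cases r)
  have inv: "X \<subseteq> V" "f X \<le> \<sigma> * b" "\<And>Y. Y \<subseteq> V \<Longrightarrow> c \<le> g Y \<Longrightarrow> b \<le> (1 + \<epsilon>) * f Y" "int k \<le> N"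
    using r(2) by (auto simp: Inv_def bXk)
  have "f X \<le> (1 + \<epsilon>) * \<sigma> * f Y" if "scsc_optimal V f g c Y" for Y
  proof -
    have "b \<le> (1 + \<epsilon>) * f Y"
      using that inv(3) by (simp add: scsc_optimal_def is_arg_min_def)
    then have "\<sigma> * b \<le> \<sigma> * ((1 + \<epsilon>) * f Y)"
      using \<sigma> by (intro mult_left_mono) auto
    then show ?thesis
      using inv(2) by (simp add: algebra_simps)
  qed
  then have "scsc_approx V f g c ((1 + \<epsilon>) * \<sigma>) \<rho> X"
    using inv(1) r(3) bXk by (simp add: scsc_approx_def)
  then show thesis
    using that r(1) bXk inv(4) by (simp add: N_def)
qed

text \<open>The \<open>max 1\<close> allows for the first call, which precedes every certificate: if
  \<open>g V = min_singleton V g\<close> the logarithm is 0, yet \<open>V\<close> may exceed the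
  budget and force a call. The dual loop likewise starts from an empty set that covers too
  little.\<close>

theorem theorem1:
  fixes n :: nat and V :: "nat set" and f g :: "nat set \<Rightarrow> real" and \<epsilon> \<sigma> \<rho> :: real
  assumes "n \<ge> 1" and "V = {1..n}"
    and "polymatroid_on V f" and "polymatroid_on V g"
    and "\<And>j. j \<in> V \<Longrightarrow> f {j} > 0" and "\<And>j. j \<in> V \<Longrightarrow> g {j} > 0"
    and "0 < \<epsilon>" and "\<epsilon> < 1" and "\<sigma> \<ge> 1" and "0 < \<rho>" and "\<rho> \<le> 1"
  shows "(\<forall>b A. min_singleton V f \<le> b \<and> b \<le> f V \<and> scsc_approx_algorithm V f g \<sigma> \<rho> A \<longrightarrow>
           (\<exists>c X k. scsk_by_scsc V f g \<epsilon> \<sigma> b A = Some (c, X, k) \<and>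
              scsk_approx V f g b ((1 - \<epsilon>) * \<rho>) \<sigma> X \<and>
              int k \<le> max 1 \<lceil>log (1 / (1 - \<epsilon>)) (g V / min_singleton V g)\<rceil>))
       \<and> (\<forall>c B. min_singleton V g \<le> c \<and> c \<le> g V \<and> scsk_approx_algorithm V f g \<rho> \<sigma> B \<longrightarrow>
           (\<exists>b X k. scsc_by_scsk V f g \<epsilon> \<rho> c B = Some (b, X, k) \<and>
              scsc_approx V f g c ((1 + \<epsilon>) * \<sigma>) \<rho> X \<and>
              int k \<le> max 1 \<lceil>log (1 + \<epsilon>) (f V / min_singleton V f)\<rceil>))"
proof (intro conjI allI impI; elim conjE)
  have V: "finite V" "V \<noteq> {}"
    using assms(1,2) by auto
  {
    fix b A
    assume b: "min_singleton V f \<le> b" and A: "scsc_approx_algorithm V f g \<sigma> \<rho> A"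
    show "\<exists>c X k. scsk_by_scsc V f g \<epsilon> \<sigma> b A = Some (c, X, k) \<and>
        scsk_approx V f g b ((1 - \<epsilon>) * \<rho>) \<sigma> X \<and>
        int k \<le> max 1 \<lceil>log (1 / (1 - \<epsilon>)) (g V / min_singleton V g)\<rceil>"
      using scsk_by_scsc_correct[OF V assms(4) _ assms(7-11) b A] assms(6) by metis
  next
    fix c B
    assume c: "min_singleton V g \<le> c" "c \<le> g V" and B: "scsk_approx_algorithm V f g \<rho> \<sigma> B"
    have "0 < c"
      using min_singleton_pos[of V g] V assms(6) c by fastforce
    moreover have "g {} = 0" "0 \<le> \<sigma>"
      using assms(4,9) by (auto simp: polymatroid_on_def)
    ultimately show "\<exists>b X k. scsc_by_scsk V f g \<epsilon> \<rho> c B = Some (b, X, k) \<and>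
        scsc_approx V f g c ((1 + \<epsilon>) * \<sigma>) \<rho> X \<and>
        int k \<le> max 1 \<lceil>log (1 + \<epsilon>) (f V / min_singleton V f)\<rceil>"
      using scsc_by_scsk_correct[OF V assms(3) _ _ assms(7) _ assms(10) _ c(2) B] assms(5) by metis
  }
qed

end
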